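(* Let $f$ be a Keller map with a component $V$ of its finiteness variety, let $x_1=u^m$, $x_2=\sum_{i=0}^{N-1}h_iu^{m-i}+\gamma u^{m-N}$ be the associated $u$-$\gamma$ representation (see context), and write $f(\hat C(\gamma,u))=\left(\sum_{i\ge0} a_i(\gamma)u^{-i},\ \sum_{i\ge0} b_i(\gamma)u^{-i}\right)$. Let $k$ be the smallest index larger than $0$ such that one of $a_k$ or $b_k$ is nonzero. Then either $k < N - 2m$ and $$\frac{da_0}{d\gamma}b_k - \frac{db_0}{d\gamma}a_k = 0,$$ or $k = N - 2m$ and $$\frac{da_0}{d\gamma}b_k - \frac{db_0}{d\gamma}a_k = \frac{m}{k}.$$
   Context: Work over $\mathbf{C}$. $f=(f_1,f_2):X_0=\mathbf{A}^2\to Y_0=\mathbf{A}^2$ is a Keller map (polynomial, Jacobian determinant identically $1$). $V_f\subset Y_0$ is the set of points over which $f$ is not proper, and $V$ is an irreducible (codimension one) component. $X=\mathbf{P}^2\supset X_0$. $\hat X\to X$ is a composition of point blowups over the line at infinity, and $\Gamma\subset \hat X$ is an irreducible curve over infinity such that $f$ extends to a rational map on $\hat X$ that is defined almost everywhere on $\Gamma$ and maps $\Gamma$ densely onto $V$. Coordinates are chosen so that $\Gamma$ maps to a point $[1:\alpha:0]$ of the line at infinity. The $u$-$\gamma$ representation: $m\ge1$ is the order of vanishing of $1/x_1$ along $\Gamma$. Choose locally near a generic point of $\Gamma$ a function $s$ with $s^m=1/x_1$, and expand $x_2/x_1=\sum_{i\ge0}\beta_i s^i$ with $\beta_i$ local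 functions on $\Gamma$. $N$ is the first index with $\beta_N$ nonconstant, $h_i=\beta_i\in\mathbf{C}$ for $i<N$, $\gamma$ is the parameter given by $\beta_N$, and $u=s^{-1}$. Truncating after index $N$ gives $$\hat C(\gamma,u)=\Big(u^m,\ \textstyle\sum_{i=0}^{N-1}h_iu^{m-i}+\gamma u^{m-N}\Big),$$ and $f(\hat C(\gamma,u))=(a(\gamma,u),b(\gamma,u))$ with $a=\sum_{i\ge0}a_i(\gamma)u^{-i}$ and $b=\sum_{i\ge0}b_i(\gamma)u^{-i}$ polynomials in $\gamma$ and $u^{-1}$; $\gamma\mapsto(a_0(\gamma),b_0(\gamma))$ parametrizes $V$. *)

theory Defs
  imports "HOL-Complex_Analysis.Complex_Analysis" "HOL-Computational_Algebra.Computational_Algebra"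
begin

text \<open>Bivariate polynomials are \<open>complex poly poly\<close>: the coefficients are polynomials in the
  first variable and the outer variable is the second one.\<close>

definition peval :: "complex poly poly \<Rightarrow> complex \<times> complex \<Rightarrow> complex" where
  "peval P = (\<lambda>(x, y). poly (poly P [:y:]) x)"

type_synonym pmap = "complex poly poly \<times> complex poly poly"

definition pmap_eval :: "pmap \<Rightarrow> complex \<times> complex \<Rightarrow> complex \<times> complex" where
  "pmap_eval f p = (peval (fst f) p, peval (snd f) p)"

definition jacobian :: "pmap \<Rightarrow> complex poly poly" where
  "jacobian f = map_poly pderiv (fst f) * pderiv (snd f) - pderiv (fst f) * map_poly pderiv (snd f)"

definition keller :: "pmap \<Rightarrow> bool" where
  "keller f \<longleftrightarrow> jacobian f = 1"


subsection \<open>The finiteness variety and its components\<close>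

text \<open>Over \<open>\<complex>\<close>, properness of a morphism of varieties is properness in the Euclidean topology.\<close>

definition nonproper_set :: "pmap \<Rightarrow> (complex \<times> complex) set" where
  "nonproper_set f = {y. \<not> (\<exists>U. open U \<and> y \<in> U \<and>
     proper_map (top_of_set (pmap_eval f -` U)) (top_of_set U) (pmap_eval f))}"

definition zariski_closed :: "(complex \<times> complex) set \<Rightarrow> bool" where
  "zariski_closed S \<longleftrightarrow> (\<exists>I. S = {p. \<forall>P\<in>I. peval P p = 0})"

definition zariski_closure :: "(complex \<times> complex) set \<Rightarrow> (complex \<times> complex) set" where
  "zariski_closure S = \<Inter>{T. zariski_closed T \<and> S \<subseteq> T}"

definition irreducible_closed :: "(complex \<times> complex) set \<Rightarrow> bool" where
  "irreducible_closed S \<longleftrightarrow> zariski_closed S \<and> S \<noteq> {} \<and>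
     (\<forall>T T'. zariski_closed T \<and> zariski_closed T' \<and> S = T \<union> T' \<longrightarrow> S = T \<or> S = T')"

definition irreducible_component :: "(complex \<times> complex) set \<Rightarrow> (complex \<times> complex) set \<Rightarrow> bool" where
  "irreducible_component V S \<longleftrightarrow> irreducible_closed V \<and> V \<subseteq> S \<and>
     (\<forall>Z. irreducible_closed Z \<and> V \<subseteq> Z \<and> Z \<subseteq> S \<longrightarrow> Z = V)"

definition codimension_one :: "(complex \<times> complex) set \<Rightarrow> bool" where
  "codimension_one V \<longleftrightarrow> V \<noteq> UNIV \<and> \<not> (\<exists>Z. irreducible_closed Z \<and> V \<subset> Z \<and> Z \<subset> UNIV)"


subsection \<open>Iterated point blowups of the projective plane over the line at infinity\<close>

text \<open>\<open>Base d\<close> is a point of the line at infinity of the projective plane: \<open>Base (Slope \<alpha>)\<close> is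
  \<open>[1:\<alpha>:0]\<close> and \<open>Base Vertical\<close> is \<open>[0:1:0]\<close>. \<open>Near p d\<close> is the point of the exceptional curve of the
  blowup of \<open>p\<close> corresponding to the tangent direction \<open>d\<close> at \<open>p\<close>, measured in the coordinates
  \<open>coords p\<close> below. So these are exactly the points over the line at infinity on
  iterated point blowups.\<close>

datatype direction = Slope complex | Vertical

datatype ipoint = Base direction | Near ipoint direction

text \<open>Algebraic coordinates \<open>(v, w)\<close> centred at a point, given by the homogeneous coordinates
  \<open>(X\<^sub>1, X\<^sub>2, X\<^sub>0)\<close>, with \<open>x\<^sub>1 = X\<^sub>1 / X\<^sub>0\<close> and \<open>x\<^sub>2 = X\<^sub>2 / X\<^sub>0\<close>, of the image in the projective plane.
  The clauses for \<open>Near\<close> are the two standard charts of the blowup of the origin of the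
  coordinates at \<open>p\<close>.\<close>

fun coords :: "ipoint \<Rightarrow> complex \<times> complex \<Rightarrow> complex \<times> complex \<times> complex" where
  "coords (Base (Slope \<alpha>)) (v, w) = (1, \<alpha> + w, v)"
| "coords (Base Vertical) (v, w) = (w, 1, v)"
| "coords (Near p (Slope c)) (v, w) = coords p (v, v * (c + w))"
| "coords (Near p Vertical) (v, w) = coords p (v * w, w)"

text \<open>A composition of point blowups is given by the list of its centres, the last centre first.
  \<open>points_over_infinity ps\<close> is the preimage of the line at infinity in the resulting surface.\<close>

fun points_over_infinity :: "ipoint list \<Rightarrow> ipoint set" where
  "points_over_infinity [] = range Base"
| "points_over_infinity (p # ps) = (points_over_infinity ps - {p}) \<union> range (Near p)"

fun blowup_sequence :: "ipoint list \<Rightarrow> bool" where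
  "blowup_sequence [] \<longleftrightarrow> True"
| "blowup_sequence (p # ps) \<longleftrightarrow> blowup_sequence ps \<and> p \<in> points_over_infinity ps"

text \<open>The irreducible curves over infinity are the strict transforms of the line at infinity and
  of the exceptional curves of the individual blowups.\<close>

datatype icurve = Line_at_infinity | Exceptional ipoint

definition curves_over_infinity :: "ipoint list \<Rightarrow> icurve set" where
  "curves_over_infinity ps = insert Line_at_infinity (Exceptional ` set ps)"

text \<open>Coordinates \<open>(v, w)\<close> near all but finitely many points of the curve, which is \<open>v = 0\<close> and has
  \<open>w\<close> as coordinate. Later blowups change neither the curve nor these coordinates
  near a generic point of the curve.\<close>

fun curve_chart :: "icurve \<Rightarrow> complex \<times> complex \<Rightarrow> complex \<times> complex \<times> complex" where
  "curve_chart Line_at_infinity (v, w) = (1, w, v)"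
| "curve_chart (Exceptional p) (v, w) = coords p (v, v * w)"

definition contracts_to :: "icurve \<Rightarrow> complex \<times> complex \<times> complex \<Rightarrow> bool" where
  "contracts_to \<Gamma> P \<longleftrightarrow> (case P of (a, b, c) \<Rightarrow>
     \<forall>w. \<exists>l. l \<noteq> 0 \<and> curve_chart \<Gamma> (0, w) = (l * a, l * b, l * c))"

definition affine_part :: "icurve \<Rightarrow> (complex \<times> complex) set" where
  "affine_part \<Gamma> = {q. case curve_chart \<Gamma> q of (X1, X2, X0) \<Rightarrow> X0 \<noteq> 0}"

definition affine_coords :: "icurve \<Rightarrow> complex \<times> complex \<Rightarrow> complex \<times> complex" where
  "affine_coords \<Gamma> q = (case curve_chart \<Gamma> q of (X1, X2, X0) \<Rightarrow> (X1 / X0, X2 / X0))"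

text \<open>The rational functions \<open>1 / x\<^sub>1\<close> and \<open>x\<^sub>2 / x\<^sub>1\<close>, written so as to make sense at infinity.\<close>

definition inv_x1 :: "icurve \<Rightarrow> complex \<times> complex \<Rightarrow> complex" where
  "inv_x1 \<Gamma> q = (case curve_chart \<Gamma> q of (X1, X2, X0) \<Rightarrow> X0 / X1)"

definition x2_over_x1 :: "icurve \<Rightarrow> complex \<times> complex \<Rightarrow> complex" where
  "x2_over_x1 \<Gamma> q = (case curve_chart \<Gamma> q of (X1, X2, X0) \<Rightarrow> X2 / X1)"


subsection \<open>The extension of the map to a curve over infinity\<close>

text \<open>The function \<open>g\<close>, given on \<open>D\<close>, is a rational function regular at \<open>q\<close> with value \<open>c\<close>.\<close>

definition regular_value ::
    "(complex \<times> complex) set \<Rightarrow> (complex \<times> complex \<Rightarrow> complex) \<Rightarrow> complex \<times> complex \<Rightarrow> complex \<Rightarrow> bool" where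
  "regular_value D g q c \<longleftrightarrow> (\<exists>P Q. peval Q q \<noteq> 0 \<and> c = peval P q / peval Q q \<and>
     (\<forall>p\<in>D. peval Q p \<noteq> 0 \<longrightarrow> g p = peval P p / peval Q p))"

definition extends_with_value :: "pmap \<Rightarrow> icurve \<Rightarrow> complex \<Rightarrow> complex \<times> complex \<Rightarrow> bool" where
  "extends_with_value f \<Gamma> w y \<longleftrightarrow>
     regular_value (affine_part \<Gamma>) (\<lambda>q. fst (pmap_eval f (affine_coords \<Gamma> q))) (0, w) (fst y) \<and>
     regular_value (affine_part \<Gamma>) (\<lambda>q. snd (pmap_eval f (affine_coords \<Gamma> q))) (0, w) (snd y)"

definition maps_densely_onto :: "pmap \<Rightarrow> icurve \<Rightarrow> (complex \<times> complex) set \<Rightarrow> bool" where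
  "maps_densely_onto f \<Gamma> V \<longleftrightarrow>
     finite {w. \<not> (\<exists>y. extends_with_value f \<Gamma> w y)} \<and>
     zariski_closure {y. \<exists>w. extends_with_value f \<Gamma> w y} = V"


subsection \<open>The u-gamma representation\<close>

text \<open>The order of vanishing of a rational function along the curve \<open>v = 0\<close>.\<close>

definition vanishing_order :: "(complex \<times> complex \<Rightarrow> complex) \<Rightarrow> nat \<Rightarrow> bool" where
  "vanishing_order g m \<longleftrightarrow> (\<exists>P Q. (\<exists>w. peval P (0, w) \<noteq> 0) \<and> (\<exists>w. peval Q (0, w) \<noteq> 0) \<and>
     (\<forall>v w. peval Q (v, w) \<noteq> 0 \<longrightarrow> g (v, w) = v ^ m * peval P (v, w) / peval Q (v, w)))"

definition holomorphic2_on :: "(complex \<times> complex \<Rightarrow> complex) \<Rightarrow> (complex \<times> complex) set \<Rightarrow> bool" where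
  "holomorphic2_on g U \<longleftrightarrow>
     (\<forall>q\<in>U. \<exists>a b. (g has_derivative (\<lambda>(dv, dw). a * dv + b * dw)) (at q within U))"

text \<open>The index \<open>N\<close>, the constants \<open>h i\<close> for \<open>i < N\<close> and the function \<open>\<beta> N\<close> on the curve do not
  depend on which coordinate \<open>w\<close> is used to regard the \<open>\<beta> i\<close> as functions near the curve.\<close>

definition ug_representation :: "icurve \<Rightarrow> nat \<Rightarrow> nat \<Rightarrow> (nat \<Rightarrow> complex) \<Rightarrow> bool" where
  "ug_representation \<Gamma> m N h \<longleftrightarrow> m \<ge> 1 \<and> vanishing_order (inv_x1 \<Gamma>) m \<and>
     (\<exists>w0 r s \<beta>. r > 0 \<and>
        holomorphic2_on s (ball 0 r \<times> ball w0 r) \<and>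
        (\<forall>i. \<beta> i holomorphic_on ball w0 r) \<and>
        (\<forall>v\<in>ball 0 r. \<forall>w\<in>ball w0 r.
           s (v, w) ^ m = inv_x1 \<Gamma> (v, w) \<and>
           (\<lambda>i. \<beta> i w * s (v, w) ^ i) sums x2_over_x1 \<Gamma> (v, w)) \<and>
        (\<forall>i<N. \<forall>w\<in>ball w0 r. \<beta> i w = h i) \<and>
        \<not> \<beta> N constant_on ball w0 r)"

definition C_hat :: "nat \<Rightarrow> nat \<Rightarrow> (nat \<Rightarrow> complex) \<Rightarrow> complex \<Rightarrow> complex \<Rightarrow> complex \<times> complex" where
  "C_hat m N h \<gamma> u =
     (u ^ m, (\<Sum>i<N. h i * u powi (int m - int i)) + \<gamma> * u powi (int m - int N))"

end

theory Submission
  imports Defs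
begin

text \<open>Put \<open>t = 1 / u\<close>. The map \<open>(\<gamma>, t) \<mapsto> C_hat m N h \<gamma> u\<close> has Jacobian determinant
  \<open>m t^(N - 2m - 1)\<close> and \<open>f\<close> has Jacobian determinant 1, so by the chain rule the polynomial map
  \<open>(a, b)\<close> of \<open>(\<gamma>, t)\<close> has Jacobian determinant \<open>m t^(N - 2m - 1)\<close>. On the other hand the lowest
  possible term of this determinant is \<open>k (a\<^sub>0' b\<^sub>k - b\<^sub>0' a\<^sub>k) t^(k - 1)\<close>. Comparing the two gives
  the theorem.\<close>

lemma peval_0 [simp]: "peval 0 p = 0"
  and peval_1 [simp]: "peval 1 p = 1"
  and peval_diff: "peval (P - Q) p = peval P p - peval Q p"
  and peval_mult: "peval (P * Q) p = peval P p * peval Q p"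
  and peval_pCons: "peval (pCons a P) p = poly a (fst p) + snd p * peval P p"
  and peval_add: "peval (P + Q) p = peval P p + peval Q p"
  by (simp_all add: peval_def split_beta)

lemma peval_monom: "peval (monom a n) (x, y) = poly a x * y ^ n"
  by (simp add: peval_def poly_monom)

lemma peval_eq_sum: "peval P (x, y) = (\<Sum>i\<le>degree P. poly (coeff P i) x * y ^ i)"
  by (simp add: peval_def poly_altdef[of P] poly_sum)

text \<open>As the second variable is the outer one, \<open>map_poly pderiv\<close> is the partial
  derivative in the first variable and \<open>pderiv\<close> the one in the second. The
  \<open>pCons\<close> case is the product rule for \<open>snd q * peval P q\<close>.\<close>

lemma has_derivative_peval:
  "(peval P has_derivative
     (\<lambda>d. peval (map_poly pderiv P) p * fst d + peval (pderiv P) p * snd d)) (at p)"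
proof (induction P)
  case 0
  have "peval 0 = (\<lambda>p. 0)" by auto
  then show ?case by simp
next
  case (pCons a P)
  have "((\<lambda>q. poly a (fst q)) has_derivative (\<lambda>d. poly (pderiv a) (fst p) * fst d)) (at p)"
    by (rule has_derivative_compose[of fst fst p UNIV "poly a", OF has_derivative_fst[OF has_derivative_ident]])
      (use poly_DERIV[of a "fst p"] in \<open>simp add: has_field_derivative_def\<close>)
  from has_derivative_add[OF this
      has_derivative_mult[OF has_derivative_snd[OF has_derivative_ident] pCons.IH]]
  have "((\<lambda>q. poly a (fst q) + snd q * peval P q) has_derivative
      (\<lambda>d. poly (pderiv a) (fst p) * fst d + (snd p * (peval (map_poly pderiv P) p * fst d +
        peval (pderiv P) p * snd d) + snd d * peval P p))) (at p)" .
  moreover have "map_poly pderiv (pCons a P) = pCons (pderiv a) (map_poly pderiv P)"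
    using pCons.hyps by (simp add: map_poly_pCons)
  ultimately show ?case
    by (simp add: peval_pCons[abs_def] pderiv_pCons peval_add algebra_simps)
qed

lemma DERIV_peval:
  assumes "(x has_field_derivative dx) (at t)" "(y has_field_derivative dy) (at t)"
  shows "((\<lambda>s. peval P (x s, y s)) has_field_derivative
    (peval (map_poly pderiv P) (x t, y t) * dx + peval (pderiv P) (x t, y t) * dy)) (at t)"
proof -
  have "((\<lambda>s. (x s, y s)) has_derivative (\<lambda>d. (dx * d, dy * d))) (at t)"
    using assms by (intro has_derivative_Pair) (simp_all add: has_field_derivative_def)
  from has_derivative_compose[OF this has_derivative_peval]
  show ?thesis
    unfolding has_field_derivative_def
    by (rule has_derivative_eq_rhs) (simp add: algebra_simps fun_eq_iff)
qed

text \<open>Points with y = 0 are left out because the substitution u = 1 / t makes sense only for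
  nonzero t. Every other y makes the constant polynomial \<open>[:y:]\<close> a root of
  \<open>P - Q\<close> over the domain \<open>complex poly\<close>, and a nonzero polynomial has
  only finitely many roots.\<close>

lemma peval_eqI:
  assumes "\<And>x y. y \<noteq> 0 \<Longrightarrow> peval P (x, y) = peval Q (x, y)"
  shows "P = Q"
proof (rule ccontr)
  assume "P \<noteq> Q"
  then have "finite {z. poly (P - Q) z = 0}"
    by (intro poly_roots_finite) simp
  moreover have "(\<lambda>y. [:y:]) ` (- {0}) \<subseteq> {z. poly (P - Q) z = 0}"
    using assms by (auto simp: peval_def poly_eq_poly_eq_iff[symmetric] fun_eq_iff)
  ultimately have "finite ((\<lambda>y::complex. [:y:]) ` (- {0}))"
    by (rule rev_finite_subset)
  then have "finite (- {0::complex})"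
    by (rule finite_imageD) (simp add: inj_on_def)
  then show False
    using infinite_UNIV_char_0[where 'a = complex] by (simp add: Compl_eq_Diff_UNIV)
qed

text \<open>In each of the two products forming the Jacobian, the factor differentiated in the first
  variable has no terms of degree 1 to n in the second, so only its term of degree 0 contributes. It
  meets the term of degree n of a \<open>pderiv\<close>, whence the factor
  \<open>Suc n\<close>.\<close>

lemma coeff_jacobian:
  assumes "\<And>i. 0 < i \<Longrightarrow> i \<le> n \<Longrightarrow> coeff A i = 0 \<and> coeff B i = 0"
  shows "coeff (jacobian (A, B)) n = of_nat (Suc n) *
    (pderiv (coeff A 0) * coeff B (Suc n) - pderiv (coeff B 0) * coeff A (Suc n))"
proof -
  have "coeff (map_poly pderiv P * pderiv Q) n =
      of_nat (Suc n) * (pderiv (coeff P 0) * coeff Q (Suc n))"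
    if "\<And>i. 0 < i \<Longrightarrow> i \<le> n \<Longrightarrow> coeff P i = 0" for P Q :: "complex poly poly"
  proof -
    have "coeff (map_poly pderiv P * pderiv Q) n =
        (\<Sum>i\<le>n. pderiv (coeff P i) * coeff (pderiv Q) (n - i))"
      by (simp add: coeff_mult coeff_map_poly)
    also have "\<dots> = (\<Sum>i\<in>{0}. pderiv (coeff P i) * coeff (pderiv Q) (n - i))"
      using that by (intro sum.mono_neutral_right) auto
    finally show ?thesis
      by (simp add: coeff_pderiv del: of_nat_Suc)
  qed
  from this[of A B] this[of B A] assms show ?thesis
    by (simp add: jacobian_def mult.commute[of "pderiv A"] right_diff_distrib del: of_nat_Suc)
qed

lemma C_hat_has_derivative_gamma:
  "((\<lambda>\<gamma>. snd (C_hat m N h \<gamma> u)) has_field_derivative u powi (int m - int N)) (at \<gamma>)"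
  unfolding C_hat_def by (auto intro!: derivative_eq_intros)

text \<open>For the second component the mere existence of a derivative suffices: the first
  component does not depend on \<gamma>, so this entry drops out of the determinant.\<close>

lemma C_hat_has_derivative_t:
  assumes "t \<noteq> 0"
  shows "((\<lambda>t. fst (C_hat m N h \<gamma> (inverse t))) has_field_derivative
      - of_nat m * inverse t ^ Suc m) (at t)"
    and "\<exists>D. ((\<lambda>t. snd (C_hat m N h \<gamma> (inverse t))) has_field_derivative D) (at t)"
proof -
  show "((\<lambda>t. fst (C_hat m N h \<gamma> (inverse t))) has_field_derivative
      - of_nat m * inverse t ^ Suc m) (at t)"
    unfolding C_hat_def fst_conv using DERIV_power[OF DERIV_inverse[OF assms], of m]
    by (cases m) (simp_all add: algebra_simps)
  have "(\<lambda>t. snd (C_hat m N h \<gamma> (inverse t))) holomorphic_on - {0}"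
    unfolding C_hat_def snd_conv by (intro holomorphic_intros) auto
  then have "(\<lambda>t. snd (C_hat m N h \<gamma> (inverse t))) field_differentiable (at t)"
    using assms by (intro holomorphic_on_imp_differentiable_at) auto
  then show "\<exists>D. ((\<lambda>t. snd (C_hat m N h \<gamma> (inverse t))) has_field_derivative D) (at t)"
    by (simp add: field_differentiable_def)
qed

text \<open>The factor \<open>t ^ (2 * m + 1)\<close> clears denominators, since the exponent N - 2m
  - 1 is not yet known to be nonnegative.\<close>

lemma peval_jacobian_C_hat:
  assumes "keller f" and "t \<noteq> 0"
    and C: "\<And>\<gamma> t. t \<noteq> 0 \<Longrightarrow>
      pmap_eval f (C_hat m N h \<gamma> (inverse t)) = (peval A (\<gamma>, t), peval B (\<gamma>, t))"
  shows "peval (jacobian (A, B)) (\<gamma>, t) * t ^ (2 * m + 1) = of_nat m * t ^ N"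
proof -
  define c where "c = C_hat m N h \<gamma> (inverse t)"
  define e where "e = inverse t powi (int m - int N)"
  obtain D where D: "((\<lambda>t. snd (C_hat m N h \<gamma> (inverse t))) has_field_derivative D) (at t)"
    using C_hat_has_derivative_t(2)[OF \<open>t \<noteq> 0\<close>] by blast
  \<comment> \<open>Both partial derivatives of \<open>Q\<close> are computed twice, directly and
    through the chain rule for \<open>P\<close> along \<open>C_hat\<close>, and uniqueness of
    derivatives equates the results.\<close>
  have chain: "peval (map_poly pderiv Q) (\<gamma>, t) = peval (pderiv P) c * e \<and>
      peval (pderiv Q) (\<gamma>, t) =
        peval (map_poly pderiv P) c * (- of_nat m * inverse t ^ Suc m) + peval (pderiv P) c * D"
    if PQ: "\<And>\<gamma> t. t \<noteq> 0 \<Longrightarrow> peval P (C_hat m N h \<gamma> (inverse t)) = peval Q (\<gamma>, t)" for P Q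
  proof
    have "((\<lambda>\<gamma>. peval Q (\<gamma>, t)) has_field_derivative peval (map_poly pderiv Q) (\<gamma>, t)) (at \<gamma>)"
      using DERIV_peval[OF DERIV_ident DERIV_const] by simp
    moreover have "((\<lambda>\<gamma>. peval Q (\<gamma>, t)) has_field_derivative peval (pderiv P) c * e) (at \<gamma>)"
      using DERIV_peval[OF DERIV_const C_hat_has_derivative_gamma,
          of P "inverse t ^ m" m N h "inverse t" \<gamma>] PQ[OF \<open>t \<noteq> 0\<close>]
      by (simp add: c_def e_def C_hat_def)
    ultimately show "peval (map_poly pderiv Q) (\<gamma>, t) = peval (pderiv P) c * e"
      by (rule DERIV_unique)
    have "((\<lambda>t. peval Q (\<gamma>, t)) has_field_derivative peval (pderiv Q) (\<gamma>, t)) (at t)"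
      using DERIV_peval[OF DERIV_const DERIV_ident] by simp
    \<comment> \<open>The two functions of t agree only away from 0, so the derivative is
      transferred on the open set \<open>- {0}\<close>.\<close>
    moreover have "((\<lambda>t. peval Q (\<gamma>, t)) has_field_derivative
        peval (map_poly pderiv P) c * (- of_nat m * inverse t ^ Suc m) + peval (pderiv P) c * D) (at t)"
      using DERIV_peval[OF C_hat_has_derivative_t(1)[OF \<open>t \<noteq> 0\<close>, of m N h \<gamma>] D, of P]
      unfolding prod.collapse c_def[symmetric]
      by (rule has_field_derivative_transform_within_open[of _ _ _ "- {0}"])
        (use PQ \<open>t \<noteq> 0\<close> in auto)
    ultimately show "peval (pderiv Q) (\<gamma>, t) =
        peval (map_poly pderiv P) c * (- of_nat m * inverse t ^ Suc m) + peval (pderiv P) c * D"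
      by (rule DERIV_unique)
  qed
  have *: "peval (fst f) (C_hat m N h \<gamma> (inverse t)) = peval A (\<gamma>, t)"
    "peval (snd f) (C_hat m N h \<gamma> (inverse t)) = peval B (\<gamma>, t)" if "t \<noteq> 0" for \<gamma> t
    using C[OF that, of \<gamma>] by (simp_all add: pmap_eval_def)
  note derivs = chain[of "fst f" A, OF *(1)] chain[of "snd f" B, OF *(2)]
  \<comment> \<open>The two terms containing \<open>D\<close> cancel.\<close>
  have "peval (jacobian (A, B)) (\<gamma>, t) = peval (jacobian f) c * (of_nat m * inverse t ^ Suc m * e)"
    by (simp add: jacobian_def peval_diff peval_mult derivs del: power_Suc)
      (simp add: algebra_simps)
  also have "\<dots> = of_nat m * inverse t ^ Suc m * e"
    using \<open>keller f\<close> by (simp add: keller_def)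
  also have "\<dots> * t ^ (2 * m + 1) = of_nat m * t ^ N"
    using \<open>t \<noteq> 0\<close>
    by (simp add: e_def power_int_diff power_int_inverse field_simps flip: mult_2_right power_add)
  finally show ?thesis .
qed

theorem theorem13:
  fixes f :: pmap and V :: "(complex \<times> complex) set"
    and ps :: "ipoint list" and \<Gamma> :: icurve and \<alpha> :: complex
    and m N k :: nat and h :: "nat \<Rightarrow> complex"
    and A B :: "complex poly poly"
  assumes "keller f"
    and "irreducible_component V (nonproper_set f)" and "codimension_one V"
    and "blowup_sequence ps" and "\<Gamma> \<in> curves_over_infinity ps"
    and "maps_densely_onto f \<Gamma> V" and "contracts_to \<Gamma> (1, \<alpha>, 0)"
    and "ug_representation \<Gamma> m N h"
    and "\<And>\<gamma> u. u \<noteq> 0 \<Longrightarrow> pmap_eval f (C_hat m N h \<gamma> u) =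
           (\<Sum>i\<le>degree A. poly (coeff A i) \<gamma> * u powi (- int i),
            \<Sum>i\<le>degree B. poly (coeff B i) \<gamma> * u powi (- int i))"
    and "k = (LEAST i. i > 0 \<and> (coeff A i \<noteq> 0 \<or> coeff B i \<noteq> 0))"
  shows "(\<exists>i>0. coeff A i \<noteq> 0 \<or> coeff B i \<noteq> 0) \<and>
    ((int k < int N - 2 * int m \<and>
        pderiv (coeff A 0) * coeff B k - pderiv (coeff B 0) * coeff A k = 0) \<or>
     (int k = int N - 2 * int m \<and>
        pderiv (coeff A 0) * coeff B k - pderiv (coeff B 0) * coeff A k = [:of_nat m / of_nat k:]))"
proof -
  have m: "m \<ge> 1"
    using assms(8) by (simp add: ug_representation_def)
  have C: "pmap_eval f (C_hat m N h \<gamma> (inverse t)) = (peval A (\<gamma>, t), peval B (\<gamma>, t))"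
    if "t \<noteq> 0" for \<gamma> t
    using assms(9)[of "inverse t" \<gamma>] that
    by (simp add: peval_eq_sum power_int_minus power_inverse)
  have "jacobian (A, B) * monom 1 (2 * m + 1) = monom [:of_nat m:] N"
    by (rule peval_eqI)
      (use peval_jacobian_C_hat[OF assms(1) _ C] in \<open>simp add: peval_mult peval_monom\<close>)
  then have J: "coeff (jacobian (A, B) * monom 1 (2 * m + 1)) i =
      (if i = N then [:of_nat m:] else 0)" for i
    by simp
  \<comment> \<open>The left side of \<open>J\<close> is divisible by
    \<open>t ^ (2 * m + 1)\<close>, and its coefficient at N is m, which is nonzero.\<close>
  have N: "2 * m + 1 \<le> N"
    using J[of N] m by (auto simp: coeff_monom_mult mult.commute[of "jacobian _"] split: if_splits)
  \<comment> \<open>The Jacobian of \<open>(A, B)\<close> is thus exactly \<open>m * t ^ n\<close>,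
    and N - 2m is \<open>Suc n\<close>.\<close>
  define n where "n = N - (2 * m + 1)"
  have Jn: "coeff (jacobian (A, B)) i = (if i = n then [:of_nat m:] else 0)" for i
    using J[of "i + (2 * m + 1)"] N
    by (auto simp: coeff_monom_mult mult.commute[of "jacobian _"] n_def)
  \<comment> \<open>If all these coefficients vanished, \<open>coeff_jacobian\<close> would give 0
    instead of m at degree n. The bound \<open>Suc n\<close> on the index is what yields k \<le> N -
    2m.\<close>
  have ex: "\<exists>i>0. i \<le> Suc n \<and> (coeff A i \<noteq> 0 \<or> coeff B i \<noteq> 0)"
  proof (rule ccontr)
    assume "\<not> ?thesis"
    then have "coeff A i = 0 \<and> coeff B i = 0" if "0 < i" "i \<le> Suc n" for i
      using that by blast
    then show False
      using coeff_jacobian[of n A B] Jn[of n] m by simp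
  qed
  then obtain i where i: "i > 0 \<and> (coeff A i \<noteq> 0 \<or> coeff B i \<noteq> 0)" "i \<le> Suc n"
    by blast
  have "k > 0"
    using LeastI[of "\<lambda>i. i > 0 \<and> (coeff A i \<noteq> 0 \<or> coeff B i \<noteq> 0)" i, OF i(1)] by (simp add: assms(10))
  have "k \<le> Suc n"
    using Least_le[of "\<lambda>i. i > 0 \<and> (coeff A i \<noteq> 0 \<or> coeff B i \<noteq> 0)" i, OF i(1)] i(2) by (simp add: assms(10))
  have "coeff A j = 0 \<and> coeff B j = 0" if "0 < j" "j \<le> k - 1" for j
    using not_less_Least[of j "\<lambda>i. i > 0 \<and> (coeff A i \<noteq> 0 \<or> coeff B i \<noteq> 0)"] that \<open>k > 0\<close>
    unfolding assms(10)[symmetric] by auto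
  \<comment> \<open>Minimality of k allows \<open>coeff_jacobian\<close> at degree k - 1, where the
    Jacobian has coefficient m if k - 1 = n and 0 otherwise.\<close>
  from coeff_jacobian[of "k - 1", OF this] \<open>k > 0\<close>
  have eq: "of_nat k * (pderiv (coeff A 0) * coeff B k - pderiv (coeff B 0) * coeff A k) =
      (if k = Suc n then [:of_nat m:] else 0)"
    by (cases k) (simp_all add: Jn)
  show ?thesis
  proof (cases "k = Suc n")
    case True
    \<comment> \<open>Rewriting the factor k as a scalar allows cancelling it, as k is nonzero in
      the complex numbers.\<close>
    have "smult (of_nat k) (pderiv (coeff A 0) * coeff B k - pderiv (coeff B 0) * coeff A k) =
        smult (of_nat k) [:of_nat m / of_nat k:]"
      using eq True by (simp add: of_nat_poly del: of_nat_Suc)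
    then have "pderiv (coeff A 0) * coeff B k - pderiv (coeff B 0) * coeff A k =
        [:of_nat m / of_nat k:]"
      using \<open>k > 0\<close> by (subst (asm) smult_eq_iff) auto
    moreover have "int k = int N - 2 * int m"
      using True N by (simp add: n_def)
    ultimately show ?thesis
      using i(1) by blast
  next
    case False
    then have "int k < int N - 2 * int m"
      using \<open>k \<le> Suc n\<close> N by (simp add: n_def)
    moreover have "pderiv (coeff A 0) * coeff B k - pderiv (coeff B 0) * coeff A k = 0"
      using eq False \<open>k > 0\<close> by simp
    ultimately show ?thesis
      using i(1) by blast
  qed
qed

end
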